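(* Let $n\ge 2$. The $n$-compartment mammillary (star) model with input, output, and leak in compartment $1$ only is generically locally identifiable, and the equation of its singular locus (defined up to sign) is $$(a_{12}a_{13}\cdots a_{1,n})\prod_{2\le i<j\le n}(a_{1i}-a_{1j})^2 .$$
   Context: A linear compartmental model $(G,In,Out,Leak)$ consists of a finite directed graph $G=(V,E)$ with $V=\{1,\dots,n\}$ and subsets $In,Out,Leak\subseteq V$. Each edge $i\to j$ carries a parameter $a_{ji}$ and each leak $i\in Leak$ a parameter $a_{0i}$ (independent real variables). The compartmental matrix is the $n\times n$ matrix $A$ with $A_{ij}=a_{ij}$ if $i\ne j$ and $j\to i$ is an edge, $A_{ij}=0$ if $i\ne j$ and $j\to i$ is not an edge, and $A_{ii}=-\sum_{k:\,i\to k\in E}a_{ki}$, with an additional summand $-a_{0i}$ if $i\in Leak$. The $n$-compartment mammillary (star) model has edges $1\to j$ (parameter $a_{j1}$) and $j\to 1$ (parameter $a_{1j}$) for $j=2,\dots,n$, no other edges, and $In=Out=Leak=\{1\}$ (leak parameter $a_{01}$); it has $2n-1$ parameters. For $In=Out=\{1\}$, write $\det(\lambda I-A)=\lambda^n+c_{n-1}\lambda^{n-1}+\dots+c_0$ and $\det((\lambda I-A)_{11})=\lambda^{n-1}+d_{n-2}\lambda^{n-2}+\dots+d_0$, where $(\cdot)_{11}$ means removing row 1 and column 1. The coefficient map is the polynomial map $c=(c_0,\dots,c_{n-1},d_0,\dots,d_{n-2}):\mathbb{R}^{|E|+|Leak|}\to\mathbb{R}^{2n-1}$. The model is generically locally identifiable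 if, outside a set of measure zero, every point of $\mathbb{R}^{|E|+|Leak|}$ has an open neighborhood on which $c$ is one-to-one. When the number of parameters equals the number of coefficients, $|E|+|Leak|=2n-1$ (as is the case here), the equation of the singular locus of a generically locally identifiable model is the polynomial $\det(\mathrm{Jac}(c))$, the determinant of the Jacobian matrix of $c$; it is defined only up to sign, since the orders of coefficients and parameters are not specified. *)

theory Defs
  imports
    "HOL-Analysis.Analysis"
    "Jordan_Normal_Form.Char_Poly"
    "Graph_Theory.Graph_Theory"
begin

text \<open>
  The vertex set is \<open>{1..n}\<close>. The arc \<open>(i, j)\<close> is the edge from \<open>i\<close> to \<open>j\<close>; its parameter
  \<open>a\<^sub>j\<^sub>i\<close> has the index \<open>(j, i)\<close> (target first). The parameter of a leak \<open>i\<close> has the index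
  \<open>(0, i)\<close>, which is never the index of an edge because 0 is not a vertex.
\<close>

record compartmental_model =
  graph :: "nat pair_pre_digraph"
  inputs :: "nat set"
  outputs :: "nat set"
  leaks :: "nat set"

definition num_compartments :: "compartmental_model \<Rightarrow> nat" where
  "num_compartments M = card (pverts (graph M))"

definition linear_compartmental_model :: "compartmental_model \<Rightarrow> bool" where
  "linear_compartmental_model M \<longleftrightarrow>
     pair_fin_digraph (graph M) \<and>
     pverts (graph M) = {1..num_compartments M} \<and>
     inputs M \<subseteq> pverts (graph M) \<and>
     outputs M \<subseteq> pverts (graph M) \<and>
     leaks M \<subseteq> pverts (graph M)"

definition params :: "compartmental_model \<Rightarrow> (nat \<times> nat) set" where
  "params M = {(j, i) |i j. (i, j) \<in> parcs (graph M)} \<union> {(0, i) |i. i \<in> leaks M}"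

text \<open>
  The number of parameters depends on the model, so the space of real parameter vectors is the
  set of functions on \<open>params M\<close> (extended by \<open>undefined\<close> elsewhere), with the product topology
  and the product of the Lebesgue-Borel measures. It is finite-dimensional, since \<open>params M\<close> is
  finite.
\<close>

definition param_space :: "compartmental_model \<Rightarrow> (nat \<times> nat \<Rightarrow> real) set" where
  "param_space M = (\<Pi>\<^sub>E p\<in>params M. UNIV)"

definition param_topology :: "compartmental_model \<Rightarrow> (nat \<times> nat \<Rightarrow> real) topology" where
  "param_topology M = product_topology (\<lambda>_. euclideanreal) (params M)"

definition param_measure :: "compartmental_model \<Rightarrow> (nat \<times> nat \<Rightarrow> real) measure" where
  "param_measure M = (\<Pi>\<^sub>M p\<in>params M. lborel)"

definition compartmental_entry ::
    "compartmental_model \<Rightarrow> (nat \<times> nat \<Rightarrow> real) \<Rightarrow> nat \<Rightarrow> nat \<Rightarrow> real" where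
  "compartmental_entry M a i j =
     (if i \<noteq> j then (if (j, i) \<in> parcs (graph M) then a (i, j) else 0)
      else - (\<Sum>k | (i, k) \<in> parcs (graph M). a (k, i)) - (if i \<in> leaks M then a (0, i) else 0))"

text \<open>Matrix positions are counted from 0, compartments from 1.\<close>

definition compartmental_matrix ::
    "compartmental_model \<Rightarrow> (nat \<times> nat \<Rightarrow> real) \<Rightarrow> real mat" where
  "compartmental_matrix M a =
     mat (num_compartments M) (num_compartments M)
       (\<lambda>(i, j). compartmental_entry M a (Suc i) (Suc j))"

text \<open>
  The coefficient map \<open>(c\<^sub>0, \<dots>, c\<^bsub>n-1\<^esub>, d\<^sub>0, \<dots>, d\<^bsub>n-2\<^esub>)\<close>. This form of the map, and hence each of
  the notions below, is meant for models with input and output in compartment 1 only.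
\<close>

definition num_coeffs :: "compartmental_model \<Rightarrow> nat" where
  "num_coeffs M = num_compartments M + (num_compartments M - 1)"

definition coeff_map ::
    "compartmental_model \<Rightarrow> (nat \<times> nat \<Rightarrow> real) \<Rightarrow> real Matrix.vec" where
  "coeff_map M a =
    (let n = num_compartments M; A = compartmental_matrix M a in
     Matrix.vec (num_coeffs M)
       (\<lambda>k. if k < n then coeff (char_poly A) k
            else coeff (Determinant.det (mat_delete (char_poly_matrix A) 0 0)) (k - n)))"

definition generically_locally_identifiable :: "compartmental_model \<Rightarrow> bool" where
  "generically_locally_identifiable M \<longleftrightarrow>
     (AE a in param_measure M.
        \<exists>U. openin (param_topology M) U \<and> a \<in> U \<and> inj_on (coeff_map M) U)"

definition partial_deriv ::
    "((nat \<times> nat \<Rightarrow> real) \<Rightarrow> real) \<Rightarrow> nat \<times> nat \<Rightarrow> (nat \<times> nat \<Rightarrow> real) \<Rightarrow> real" where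
  "partial_deriv f p a = deriv (\<lambda>t. f (a(p := t))) (a p)"

text \<open>
  The rows of the Jacobian matrix are the coefficients in the order \<open>\<sigma>\<close>, its columns the
  parameters in the order \<open>\<tau>\<close>.
\<close>

definition coeff_jacobian ::
    "compartmental_model \<Rightarrow> (nat \<Rightarrow> nat) \<Rightarrow> (nat \<Rightarrow> nat \<times> nat) \<Rightarrow>
     (nat \<times> nat \<Rightarrow> real) \<Rightarrow> real mat" where
  "coeff_jacobian M \<sigma> \<tau> a =
     mat (num_coeffs M) (card (params M))
       (\<lambda>(k, l). partial_deriv (\<lambda>x. vec_index (coeff_map M x) (\<sigma> k)) (\<tau> l) a)"

text \<open>
  \<open>f\<close> is the equation of the singular locus: for all orders of the coefficients and the
  parameters, \<open>f\<close> agrees with the Jacobian determinant up to a sign that does not depend on the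
  point. Polynomials are represented by the functions they define on the parameter space.
\<close>

definition singular_locus_equation ::
    "compartmental_model \<Rightarrow> ((nat \<times> nat \<Rightarrow> real) \<Rightarrow> real) \<Rightarrow> bool" where
  "singular_locus_equation M f \<longleftrightarrow>
     finite (params M) \<and> card (params M) = num_coeffs M \<and>
     (\<forall>\<sigma> \<tau>. bij_betw \<sigma> {..<num_coeffs M} {..<num_coeffs M} \<longrightarrow>
            bij_betw \<tau> {..<card (params M)} (params M) \<longrightarrow>
        (\<exists>s\<in>{1, -1}. \<forall>a\<in>param_space M.
            Determinant.det (coeff_jacobian M \<sigma> \<tau> a) = s * f a))"

definition mammillary :: "nat \<Rightarrow> compartmental_model" where
  "mammillary n =
     \<lparr> graph = \<lparr> pverts = {1..n}, parcs = {(1, j) |j. j \<in> {2..n}} \<union> {(j, 1) |j. j \<in> {2..n}} \<rparr>,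
       inputs = {1}, outputs = {1}, leaks = {1} \<rparr>"

lemma linear_compartmental_model_mammillary:
  assumes "n \<ge> 2"
  shows "linear_compartmental_model (mammillary n)"
  using assms
  by (auto simp: linear_compartmental_model_def mammillary_def num_compartments_def
      intro!: pair_fin_digraph.intro pair_wf_digraph.intro pair_fin_digraph_axioms.intro)

lemma params_mammillary:
  "params (mammillary n) = insert (0, 1) ((\<lambda>j. (j, 1)) ` {2..n} \<union> (\<lambda>j. (1, j)) ` {2..n})"
  by (auto simp: params_def mammillary_def)

lemma card_params_mammillary:
  assumes "n \<ge> 2"
  shows "card (params (mammillary n)) = 2 * n - 1"
proof -
  have "card ((\<lambda>j. (j, 1::nat)) ` {2..n} \<union> (\<lambda>j. (1::nat, j)) ` {2..n}) = (n - 1) + (n - 1)"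
    by (subst card_Un_disjoint) (auto simp: card_image inj_on_def)
  then show ?thesis
    unfolding params_mammillary using assms by (subst card_insert_disjoint) auto
qed

end

theory Submission
  imports Defs
begin

text \<open>
  Write \<open>x\<^sub>l\<close>, \<open>y\<^sub>l\<close> for the parameters of the edges into and out of compartment 1 and \<open>z\<close> for the
  leak. The two polynomials of the coefficient map are \<open>D = \<Prod>\<^sub>l (\<lambda> + x\<^sub>l)\<close> and
  \<open>P = (\<lambda> + z) D + \<lambda> \<Sum>\<^sub>l y\<^sub>l D\<^sub>l\<close> with \<open>D\<^sub>l = \<Prod>\<^bsub>i \<noteq> l\<^esub> (\<lambda> + x\<^sub>i)\<close>. Since \<open>D\<close> depends on the \<open>x\<^sub>l\<close> only
  and \<open>P\<close> is affine in \<open>z\<close> and the \<open>y\<^sub>l\<close>, the Jacobian matrix is block triangular, and both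
  diagonal blocks reduce to the coefficient matrix \<open>C\<close> of the \<open>D\<^sub>l\<close>: its determinant is
  \<open>\<Prod>\<^sub>l x\<^sub>l (det C)\<^sup>2\<close>, and \<open>det C\<close> is a Vandermonde product up to sign.
  If the \<open>x\<^sub>l\<close> are nonzero and distinct, which holds almost everywhere, then locally the roots of
  \<open>D\<close> determine the \<open>x\<^sub>l\<close>, and evaluating \<open>P\<close> at \<open>0\<close> and at the \<open>-x\<^sub>l\<close> gives \<open>z\<close> and the \<open>y\<^sub>l\<close>,
  so no inverse function theorem is needed.
\<close>

subsection \<open>Coefficients of products of linear factors\<close>

definition root_poly :: "('b \<Rightarrow> 'a) \<Rightarrow> 'b set \<Rightarrow> 'a::comm_ring_1 poly" where
  "root_poly x S = (\<Prod>l\<in>S. [:x l, 1:])"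

lemma root_poly_remove:
  assumes "finite S" "l \<in> S"
  shows "root_poly x S = [:x l, 1:] * root_poly x (S - {l})"
  unfolding root_poly_def using assms by (rule prod.remove)

lemma degree_root_poly [simp]:
  fixes x :: "'b \<Rightarrow> 'a::idom"
  shows "degree (root_poly x S) = card S"
  unfolding root_poly_def by (subst degree_prod_eq_sum_degree) auto

lemma coeff_root_poly_card:
  fixes x :: "'b \<Rightarrow> 'a::idom"
  shows "coeff (root_poly x S) (card S) = 1"
proof -
  have "lead_coeff (root_poly x S) = 1"
    unfolding root_poly_def lead_coeff_prod by (intro prod.neutral) simp
  then show ?thesis by simp
qed

lemma coeff_root_poly_eq_0:
  fixes x :: "'b \<Rightarrow> 'a::idom"
  shows "card S < k \<Longrightarrow> coeff (root_poly x S) k = 0"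
  by (rule coeff_eq_0) simp

lemma poly_root_poly: "poly (root_poly x S) t = (\<Prod>l\<in>S. x l + t)"
  by (simp add: root_poly_def poly_prod)

lemma root_poly_upd_notin: "l \<notin> S \<Longrightarrow> root_poly (x(l := t)) S = root_poly x S"
  unfolding root_poly_def by (intro prod.cong) auto

text \<open>Column \<open>l\<close> lists elementary symmetric polynomials in the variables other
  than \<open>x l\<close>. Since the derivative of \<open>root_poly x {..<m}\<close> in
  \<open>x l\<close> omits the factor \<open>l\<close>, this is also the Jacobian matrix of the
  non-leading coefficients of that product.\<close>

definition minor_coeff_mat :: "(nat \<Rightarrow> 'a::comm_ring_1) \<Rightarrow> nat \<Rightarrow> 'a mat" where
  "minor_coeff_mat x m = mat m m (\<lambda>(k, l). coeff (root_poly x ({..<m} - {l})) k)"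

lemma minor_coeff_mat_carrier [simp]:
  "minor_coeff_mat x m \<in> carrier_mat m m"
  by (simp add: minor_coeff_mat_def)

lemma dim_minor_coeff_mat [simp]:
  "dim_row (minor_coeff_mat x m) = m" "dim_col (minor_coeff_mat x m) = m"
  by (simp_all add: minor_coeff_mat_def)

text \<open>Split the factor belonging to \<open>m\<close> into the constant
  \<open>x m - x l\<close> and the factor belonging to \<open>l\<close>; the latter restores the
  missing factor.\<close>

lemma root_poly_lessThan_Suc_diff:
  assumes "l < m"
  shows "root_poly x ({..<Suc m} - {l}) =
    Polynomial.smult (x m - x l) (root_poly x ({..<m} - {l})) + root_poly x {..<m}"
proof -
  have "root_poly x ({..<Suc m} - {l}) = [:x m, 1:] * root_poly x ({..<m} - {l})"
  proof -
    have "{..<Suc m} - {l} - {m} = {..<m} - {l}" by auto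
    then show ?thesis using assms root_poly_remove[of "{..<Suc m} - {l}" m x] by simp
  qed
  also have "[:x m, 1:] = [:x m - x l:] + [:x l, 1:]"
    by simp
  also have "\<dots> * root_poly x ({..<m} - {l}) =
      Polynomial.smult (x m - x l) (root_poly x ({..<m} - {l})) + root_poly x {..<m}"
    using assms root_poly_remove[of "{..<m}" l x] by (simp only: distrib_right) simp
  finally show ?thesis .
qed

text \<open>Subtracting the last column from column \<open>l\<close> leaves \<open>x m - x l\<close> times the corresponding
  column for \<open>m\<close> variables.\<close>

lemma det_minor_coeff_mat_Suc:
  fixes x :: "nat \<Rightarrow> 'a::idom"
  shows "Determinant.det (minor_coeff_mat x (Suc m)) =
    Determinant.det (minor_coeff_mat x m) * (\<Prod>l<m. x m - x l)"
proof -
  define B where "B = mat (Suc m) (Suc m)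
    (\<lambda>(k, l). coeff (root_poly x (if l < m then {..<m} - {l} else {..<m})) k)"
  \<comment> \<open>\<open>T\<close> undoes the column operation: it scales column \<open>l\<close>
    of \<open>B\<close> by \<open>x m - x l\<close>, adds the last column, and keeps the last column
    itself.\<close>
  define T where "T = mat (Suc m) (Suc m)
    (\<lambda>(i, l). if i = m then 1 else if i = l then x m - x l else 0)"
  have B: "B \<in> carrier_mat (Suc m) (Suc m)" and T: "T \<in> carrier_mat (Suc m) (Suc m)"
    by (simp_all add: B_def T_def)
  have "minor_coeff_mat x (Suc m) = B * T"
  proof (rule eq_matI)
    fix k l assume "k < dim_row (B * T)" "l < dim_col (B * T)"
    then have k: "k < Suc m" and l: "l < Suc m" by (simp_all add: B_def T_def)
    have "(B * T) $$ (k, l) = (\<Sum>i<Suc m. B $$ (k, i) * T $$ (i, l))"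
      using k l B T by (simp add: scalar_prod_def lessThan_atLeast0)
    also have "\<dots> = (\<Sum>i<m. B $$ (k, i) * T $$ (i, l)) + B $$ (k, m)"
      using l by (simp add: T_def)
    also have "(\<Sum>i<m. B $$ (k, i) * T $$ (i, l)) =
        (\<Sum>i<m. if i = l then B $$ (k, l) * (x m - x l) else 0)"
      using l by (intro sum.cong) (auto simp: T_def)
    also have "\<dots> = (if l < m then B $$ (k, l) * (x m - x l) else 0)"
      by simp
    also have "\<dots> + B $$ (k, m) = coeff (root_poly x ({..<Suc m} - {l})) k"
    proof (cases "l = m")
      case True
      moreover have "{..<Suc m} - {m} = {..<m}" by auto
      ultimately show ?thesis using k by (simp add: B_def)
    next
      case False
      then have "l < m" using l by simp
      then show ?thesis using k l
        by (simp add: B_def root_poly_lessThan_Suc_diff mult.commute)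
    qed
    finally show "minor_coeff_mat x (Suc m) $$ (k, l) = (B * T) $$ (k, l)"
      using k l by (simp add: minor_coeff_mat_def)
  qed (simp_all add: minor_coeff_mat_def B_def T_def)
  then have "Determinant.det (minor_coeff_mat x (Suc m)) = Determinant.det B * Determinant.det T"
    by (simp add: det_mult[OF B T])
  \<comment> \<open>The bottom row holds the coefficients of degree \<open>m\<close>: only the full
    product, which is monic of degree \<open>m\<close>, contributes.\<close>
  also have "B = four_block_mat (minor_coeff_mat x m)
      (mat m 1 (\<lambda>(k, _). coeff (root_poly x {..<m}) k)) (0\<^sub>m 1 m) (1\<^sub>m 1)"
  proof (rule eq_matI, goal_cases)
    case (1 k l)
    then have k: "k < Suc m" and l: "l < Suc m" by (simp_all add: minor_coeff_mat_def)
    have "coeff (root_poly x ({..<m} - {l})) m = 0" if "l < m"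
      using that by (intro coeff_root_poly_eq_0) auto
    moreover have "coeff (root_poly x {..<m}) m = 1"
      using coeff_root_poly_card[of x "{..<m}"] by simp
    ultimately show ?case
      using k l by (cases "k = m"; cases "l = m")
        (auto simp: B_def four_block_mat_def minor_coeff_mat_def Let_def)
  qed (simp_all add: B_def minor_coeff_mat_def)
  also have "Determinant.det \<dots> = Determinant.det (minor_coeff_mat x m)"
    by (subst det_four_block_mat_lower_left_zero) auto
  also have "Determinant.det T = (\<Prod>l<m. x m - x l)"
    by (subst det_lower_triangular[OF _ T])
      (auto simp: T_def prod_list_diag_prod atLeast0LessThan)
  finally show ?thesis .
qed

lemma pairs_less_Suc:
  "{(i, j). i < j \<and> j < Suc m} = {(i, j). i < j \<and> j < m} \<union> (\<lambda>i. (i, m)) ` {..<m}"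
  by auto

lemma finite_pairs_less: "finite {(i, j). i < j \<and> j < (m::nat)}"
  by (rule finite_subset[of _ "{..<m} \<times> {..<m}"]) auto

text \<open>Squaring removes the sign: the recursion yields factors \<open>x m - x l\<close>, with
  the larger index first.\<close>

lemma det_minor_coeff_mat_square:
  fixes x :: "nat \<Rightarrow> 'a::idom"
  shows "(Determinant.det (minor_coeff_mat x m))\<^sup>2 =
    (\<Prod>(i, j) | i < j \<and> j < m. (x i - x j)\<^sup>2)"
proof (induction m)
  case 0
  then show ?case by (simp add: minor_coeff_mat_def)
next
  case (Suc m)
  have "(\<Prod>(i, j) | i < j \<and> j < Suc m. (x i - x j)\<^sup>2) =
      (\<Prod>(i, j) | i < j \<and> j < m. (x i - x j)\<^sup>2) * (\<Prod>l<m. (x l - x m)\<^sup>2)"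
    unfolding pairs_less_Suc
    by (subst prod.union_disjoint) (auto simp: finite_pairs_less prod.reindex inj_on_def)
  then show ?case
    by (simp add: det_minor_coeff_mat_Suc power_mult_distrib Suc.IH prod_power_distrib
        power2_commute[of "x m"])
qed

subsection \<open>Determinants of arrow matrices and of permuted matrices\<close>

text \<open>The shape of \<lambda>I - A for a star: row and column 0 belong to the central
  compartment, and the peripheral ones interact only with it. The minus signs are those of
  -A.\<close>

definition arrow_mat :: "nat \<Rightarrow> 'a \<Rightarrow> (nat \<Rightarrow> 'a) \<Rightarrow> (nat \<Rightarrow> 'a) \<Rightarrow> (nat \<Rightarrow> 'a) \<Rightarrow> 'a::comm_ring_1 mat"
  where "arrow_mat m w u v d = mat (Suc m) (Suc m)
    (\<lambda>(i, j). case i of 0 \<Rightarrow> (case j of 0 \<Rightarrow> w | Suc l \<Rightarrow> - u l)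
       | Suc k \<Rightarrow> (case j of 0 \<Rightarrow> - v k | Suc l \<Rightarrow> if k = l then d k else 0))"

text \<open>Multiplying by the lower triangular matrix \<open>T\<close> clears the first column below the
  diagonal; the factor \<open>det T\<close> is cancelled at the end.\<close>

lemma det_arrow_mat:
  fixes d :: "nat \<Rightarrow> 'a::idom"
  assumes "\<And>l. l < m \<Longrightarrow> d l \<noteq> 0"
  shows "Determinant.det (arrow_mat m w u v d) =
    w * (\<Prod>l<m. d l) - (\<Sum>l<m. u l * v l * (\<Prod>i\<in>{..<m} - {l}. d i))" (is "_ = ?r")
proof -
  \<comment> \<open>The first column is a division-free solution: \<open>d k\<close> times its entry
    \<open>k + 1\<close> is \<open>v k\<close> times the product of all \<open>d l\<close>, which
    cancels the contribution of \<open>- v k\<close>.\<close>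
  define T where "T = mat (Suc m) (Suc m)
    (\<lambda>(i, j). case i of 0 \<Rightarrow> (case j of 0 \<Rightarrow> \<Prod>l<m. d l | Suc l \<Rightarrow> 0)
       | Suc k \<Rightarrow> (case j of 0 \<Rightarrow> v k * (\<Prod>i\<in>{..<m} - {k}. d i)
                  | Suc l \<Rightarrow> if k = l then 1 else 0))"
  let ?A = "arrow_mat m w u v d"
  have A: "?A \<in> carrier_mat (Suc m) (Suc m)" and T: "T \<in> carrier_mat (Suc m) (Suc m)"
    by (simp_all add: arrow_mat_def T_def)
  have AT: "(?A * T) $$ (i, j) = ?A $$ (i, 0) * T $$ (0, j) + (\<Sum>l<m. ?A $$ (i, Suc l) * T $$ (Suc l, j))"
    if "i < Suc m" "j < Suc m" for i j
  proof -
    have "(?A * T) $$ (i, j) = (\<Sum>l<Suc m. ?A $$ (i, l) * T $$ (l, j))"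
      using that A T by (simp add: scalar_prod_def lessThan_atLeast0)
    then show ?thesis by (simp only: sum.lessThan_Suc_shift)
  qed
  have d_remove: "d k * (\<Prod>i\<in>{..<m} - {k}. d i) = (\<Prod>l<m. d l)" if "k < m" for k
    using that by (simp add: prod.remove[of "{..<m}" k])
  have entry: "(?A * T) $$ (i, j) = (case i of 0 \<Rightarrow> (case j of 0 \<Rightarrow> ?r | Suc l \<Rightarrow> - u l)
       | Suc k \<Rightarrow> (case j of 0 \<Rightarrow> 0 | Suc l \<Rightarrow> if k = l then d k else 0))"
    if "i < Suc m" "j < Suc m" for i j
  proof (cases i)
    case 0
    show ?thesis
    proof (cases j)
      case j: (Suc l)
      have "(\<Sum>k<m. - u k * (if k = l then 1 else 0)) = - u l"
        using that j by (simp add: if_distrib sum.delta cong: if_cong)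
      with 0 j that show ?thesis by (simp add: AT) (simp add: arrow_mat_def T_def)
    qed (use 0 that in \<open>simp add: AT, simp add: arrow_mat_def T_def sum_negf mult.assoc\<close>)
  next
    case i: (Suc k)
    have *: "(\<Sum>l<m. (if k = l then d k else 0) * f l) = d k * f k" if "k < m" for k f
      using that by (simp add: if_distrib[of "\<lambda>t. t * _"] sum.delta' cong: if_cong)
    show ?thesis
    proof (cases j)
      case 0
      have "d k * (v k * (\<Prod>i\<in>{..<m} - {k}. d i)) = v k * (\<Prod>l<m. d l)"
        using i that by (simp add: mult.left_commute d_remove)
      with 0 i that show ?thesis
        by (simp add: AT) (simp add: arrow_mat_def T_def *)
    next
      case (Suc l)
      with i that show ?thesis
        by (simp add: AT) (simp add: arrow_mat_def T_def *)
    qed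
  qed
  have ut: "upper_triangular (?A * T)"
    using A T by (auto simp: entry split: nat.splits intro!: upper_triangularI)
  have "Determinant.det ?A * Determinant.det T = Determinant.det (?A * T)"
    by (simp add: det_mult[OF A T])
  also have "\<dots> = (\<Prod>i<Suc m. (?A * T) $$ (i, i))"
    using A T by (subst det_upper_triangular[OF ut])
      (auto simp: prod_list_diag_prod atLeast0LessThan simp del: index_mult_mat(1))
  also have "\<dots> = ?r * (\<Prod>l<m. d l)"
    by (subst prod.lessThan_Suc_shift) (simp add: entry)
  also have "Determinant.det T = (\<Prod>i<Suc m. T $$ (i, i))"
    by (subst det_lower_triangular[OF _ T])
      (auto simp: T_def prod_list_diag_prod atLeast0LessThan split: nat.splits)
  also have "\<dots> = (\<Prod>l<m. d l)"
    by (subst prod.lessThan_Suc_shift) (simp add: T_def)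
  finally show ?thesis using assms by simp
qed

text \<open>The sign is the product of the signs of the two permutations, hence one \<open>s\<close>
  serves all matrices. This uniformity makes the sign of the Jacobian determinant independent of the
  point.\<close>

lemma det_permute:
  assumes "bij_betw p {..<N} {..<N}" "bij_betw q {..<N} {..<N}"
  shows "\<exists>s\<in>{1, -1}. \<forall>A\<in>carrier_mat N N.
    Determinant.det (mat N N (\<lambda>(i, j). A $$ (p i, q j))) = s * Determinant.det (A :: 'a::comm_ring_1 mat)"
proof -
  \<comment> \<open>\<open>permutes\<close> demands the identity outside the index set, where
    \<open>p\<close> is arbitrary.\<close>
  have ex: "\<exists>p'. p' permutes {0..<N} \<and> (\<forall>i<N. p' i = p i)" if "bij_betw p {..<N} {..<N}" for p
    using that by (intro exI[of _ "\<lambda>i. if i < N then p i else i"])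
      (auto intro!: bij_imp_permutes simp: bij_betw_def inj_on_def atLeast0LessThan image_iff)
  obtain p' q' where p': "p' permutes {0..<N}" "\<And>i. i < N \<Longrightarrow> p' i = p i"
    and q': "q' permutes {0..<N}" "\<And>i. i < N \<Longrightarrow> q' i = q i"
    using ex[OF assms(1)] ex[OF assms(2)] by blast
  have lt: "p i < N" "q i < N" if "i < N" for i
    using assms that by (auto simp: bij_betw_def)
  have "Determinant.det (mat N N (\<lambda>(i, j). A $$ (p i, q j))) =
      of_int (sign p') * of_int (sign q') * Determinant.det A"
    if A: "A \<in> carrier_mat N N" for A :: "'a mat"
  proof -
    \<comment> \<open>Columns are permuted as rows of the transpose.\<close>
    let ?B = "mat N N (\<lambda>(i, j). A\<^sup>T $$ (q' i, j))"
    have "mat N N (\<lambda>(i, j). A $$ (p i, q j)) = mat N N (\<lambda>(i, j). ?B\<^sup>T $$ (p' i, j))"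
      using A by (intro eq_matI) (auto simp: p' q' lt)
    then show ?thesis
      using A p' q' by (simp add: det_permute_rows det_transpose[of _ N])
  qed
  moreover have "of_int (sign p') * of_int (sign q') \<in> {1, -1 :: 'a}"
    by (cases p' rule: sign_cases; cases q' rule: sign_cases) auto
  ultimately show ?thesis by blast
qed

subsection \<open>Graphs of functions are null sets\<close>

text \<open>Fubini in the coordinate \<open>p\<close>: with the other coordinates fixed,
  \<open>upd\<close> makes \<open>g\<close> constant, so each slice of the graph has at most one
  point.\<close>

lemma AE_PiM_lborel_neq:
  fixes g :: "('b \<Rightarrow> real) \<Rightarrow> real"
  assumes "finite I" "p \<in> I"
    and g [measurable]: "g \<in> borel_measurable (PiM I (\<lambda>_. lborel))"
    and upd: "\<And>a t. g (a(p := t)) = g a"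
  shows "AE a in PiM I (\<lambda>_. lborel). a p \<noteq> g a"
proof -
  interpret product_sigma_finite "\<lambda>_::'b. lborel :: real measure" ..
  define N where "N = {a \<in> space (PiM I (\<lambda>_. lborel)). a p = g a}"
  have [measurable]: "(\<lambda>a. a p) \<in> borel_measurable (PiM I (\<lambda>_. lborel))"
    using \<open>p \<in> I\<close> measurable_component_singleton[of p I "\<lambda>_. lborel"] by simp
  have N: "N \<in> sets (PiM I (\<lambda>_. lborel))"
    unfolding N_def by measurable
  have I: "insert p (I - {p}) = I"
    using \<open>p \<in> I\<close> by auto
  have "emeasure (PiM I (\<lambda>_. lborel)) N =
      (\<integral>\<^sup>+ a. indicator N a \<partial>PiM (insert p (I - {p})) (\<lambda>_. lborel))"
    unfolding I using N by simp
  also have "\<dots> = (\<integral>\<^sup>+ a. \<integral>\<^sup>+ t. indicator N (a(p := t)) \<partial>lborel \<partial>PiM (I - {p}) (\<lambda>_. lborel))"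
    using \<open>finite I\<close> N \<open>p \<in> I\<close> by (intro product_nn_integral_insert) (auto simp: insert_absorb)
  also have "\<dots> = (\<integral>\<^sup>+ a. 0 \<partial>PiM (I - {p}) (\<lambda>_. lborel :: real measure))"
  proof (intro nn_integral_cong)
    fix a :: "'b \<Rightarrow> real"
    have "(\<integral>\<^sup>+ t. indicator N (a(p := t)) \<partial>lborel) \<le> (\<integral>\<^sup>+ t. indicator {g a} t \<partial>lborel)"
      by (intro nn_integral_mono) (auto simp: N_def upd indicator_def)
    also have "\<dots> = 0" by simp
    finally show "(\<integral>\<^sup>+ t. indicator N (a(p := t)) \<partial>lborel) = 0" by simp
  qed
  finally have "emeasure (PiM I (\<lambda>_. lborel)) N = 0" by simp
  with N show ?thesis
    by (intro AE_I[of _ _ N]) (auto simp: N_def)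
qed

subsection \<open>The coefficient map of the mammillary model\<close>

text \<open>The peripheral compartments \<open>2, \<dots>, m + 1\<close> are numbered \<open>0, \<dots>, m - 1\<close>.\<close>

abbreviation inflow :: "(nat \<times> nat \<Rightarrow> real) \<Rightarrow> nat \<Rightarrow> real" where
  "inflow a \<equiv> \<lambda>l. a (Suc 0, l + 2)"

abbreviation outflow :: "(nat \<times> nat \<Rightarrow> real) \<Rightarrow> nat \<Rightarrow> real" where
  "outflow a \<equiv> \<lambda>l. a (l + 2, Suc 0)"

text \<open>The names refer to the input-output equation of the model, in which
  \<open>out_poly\<close> is applied to the output and \<open>in_poly\<close> to the input.\<close>

definition in_poly :: "nat \<Rightarrow> (nat \<times> nat \<Rightarrow> real) \<Rightarrow> real poly" where
  "in_poly m a = root_poly (inflow a) {..<m}"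

definition out_poly :: "nat \<Rightarrow> (nat \<times> nat \<Rightarrow> real) \<Rightarrow> real poly" where
  "out_poly m a = [:a (0, Suc 0), 1:] * in_poly m a +
     [:0, 1:] * (\<Sum>l<m. Polynomial.smult (outflow a l) (root_poly (inflow a) ({..<m} - {l})))"

lemma num_compartments_mammillary [simp]: "num_compartments (mammillary n) = n"
  by (simp add: num_compartments_def mammillary_def)

lemma num_coeffs_mammillary [simp]: "num_coeffs (mammillary (Suc m)) = Suc m + m"
  by (simp add: num_coeffs_def)

lemma params_mammillary_cases:
  assumes "p \<in> params (mammillary (Suc m))"
  obtains (leak) "p = (0, Suc 0)"
    | (outflow) l where "l < m" "p = (l + 2, Suc 0)"
    | (inflow) l where "l < m" "p = (Suc 0, l + 2)"
proof -
  from assms consider "p = (0, Suc 0)" | j where "2 \<le> j" "j \<le> Suc m" "p = (j, Suc 0)"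
    | j where "2 \<le> j" "j \<le> Suc m" "p = (Suc 0, j)"
    by (auto simp: params_mammillary)
  then show thesis
  proof cases
    case (2 j)
    then show thesis by (intro outflow[of "j - 2"]) auto
  next
    case (3 j)
    then show thesis by (intro inflow[of "j - 2"]) auto
  qed (rule leak)
qed

lemma sum_out_mammillary:
  "(\<Sum>k | (Suc 0, k) \<in> parcs (graph (mammillary (Suc m))). a (k, Suc 0)) = (\<Sum>l<m. outflow a l)"
proof -
  have "{k. (Suc 0, k) \<in> parcs (graph (mammillary (Suc m)))} = (\<lambda>l. l + 2) ` {..<m}"
  proof -
    have "k \<in> (\<lambda>l. l + 2) ` {..<m}" if "2 \<le> k" "k \<le> Suc m" for k
      using that by (intro image_eqI[of _ _ "k - 2"]) auto
    then show ?thesis by (auto simp: mammillary_def)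
  qed
  then show ?thesis by (simp add: sum.reindex inj_on_def)
qed

lemma char_poly_matrix_mammillary:
  "char_poly_matrix (compartmental_matrix (mammillary (Suc m)) a) =
   arrow_mat m [:a (0, Suc 0) + (\<Sum>l<m. outflow a l), 1:]
     (\<lambda>l. [:inflow a l:]) (\<lambda>l. [:outflow a l:]) (\<lambda>l. [:inflow a l, 1:])" (is "?L = ?R")
proof (rule eq_matI)
  fix i j assume "i < dim_row ?R" "j < dim_col ?R"
  then have "i < Suc m" "j < Suc m" by (simp_all add: arrow_mat_def)
  \<comment> \<open>A peripheral compartment has a single outgoing arc and no leak, so its diagonal
    entry involves just one inflow parameter.\<close>
  moreover have "{k. (Suc (Suc l), k) \<in> parcs (graph (mammillary (Suc m)))} = {Suc 0}"
    if "l < m" for l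
    using that by (auto simp: mammillary_def)
  ultimately show "?L $$ (i, j) = ?R $$ (i, j)"
    by (cases i; cases j)
      (auto simp: char_poly_matrix_def compartmental_matrix_def arrow_mat_def
        compartmental_entry_def sum_out_mammillary,
       auto simp: mammillary_def)
qed (simp_all add: arrow_mat_def char_poly_matrix_def compartmental_matrix_def)

text \<open>The arrow determinant is (\<lambda> + z + \<Sum> y_l) D - \<Sum> x_l y_l D_l. As D =
  (\<lambda> + x_l) D_l, the terms y_l D - x_l y_l D_l combine to \<lambda> y_l D_l.\<close>

lemma char_poly_mammillary:
  "char_poly (compartmental_matrix (mammillary (Suc m)) a) = out_poly m a"
proof -
  let ?x = "inflow a" and ?y = "outflow a"
  have remove: "[:?x l, 1:] * root_poly ?x ({..<m} - {l}) = in_poly m a" if "l < m" for l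
    using that by (simp only: in_poly_def root_poly_remove[of "{..<m}" l] finite_lessThan lessThan_iff)
  have sum_const: "(\<Sum>l<m. [:?y l:]) = [:\<Sum>l<m. ?y l:]"
    by (induction m) simp_all
  have "char_poly (compartmental_matrix (mammillary (Suc m)) a) =
      [:a (0, Suc 0) + (\<Sum>l<m. ?y l), 1:] * in_poly m a -
      (\<Sum>l<m. [:?x l:] * [:?y l:] * root_poly ?x ({..<m} - {l}))"
    unfolding char_poly_def char_poly_matrix_mammillary
    by (subst det_arrow_mat) (simp_all add: in_poly_def root_poly_def)
  also have "[:a (0, Suc 0) + (\<Sum>l<m. ?y l), 1:] =
      [:a (0, Suc 0), 1:] + (\<Sum>l<m. [:?y l:])"
    unfolding sum_const by simp
  also have "\<dots> * in_poly m a - (\<Sum>l<m. [:?x l:] * [:?y l:] * root_poly ?x ({..<m} - {l})) =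
      [:a (0, Suc 0), 1:] * in_poly m a +
      (\<Sum>l<m. [:?y l:] * in_poly m a - [:?x l:] * [:?y l:] * root_poly ?x ({..<m} - {l}))"
    by (simp only: distrib_right sum_distrib_right sum_subtractf)
  also have "(\<Sum>l<m. [:?y l:] * in_poly m a - [:?x l:] * [:?y l:] * root_poly ?x ({..<m} - {l})) =
      (\<Sum>l<m. [:0, 1:] * Polynomial.smult (?y l) (root_poly ?x ({..<m} - {l})))"
  proof (rule sum.cong[OF refl])
    fix l assume l: "l \<in> {..<m}"
    have "[:?y l:] * in_poly m a - [:?x l:] * [:?y l:] * root_poly ?x ({..<m} - {l}) =
      [:?y l:] * ([:?x l, 1:] - [:?x l:]) * root_poly ?x ({..<m} - {l})"
      using remove[of l] l by (simp only: algebra_simps lessThan_iff)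
    then show "[:?y l:] * in_poly m a - [:?x l:] * [:?y l:] * root_poly ?x ({..<m} - {l}) =
      [:0, 1:] * Polynomial.smult (?y l) (root_poly ?x ({..<m} - {l}))"
      by simp
  qed
  finally show ?thesis by (simp only: out_poly_def sum_distrib_left)
qed

text \<open>Deleting the central compartment leaves a diagonal matrix.\<close>

lemma minor_char_poly_mammillary:
  "Determinant.det (mat_delete (char_poly_matrix (compartmental_matrix (mammillary (Suc m)) a)) 0 0) =
   in_poly m a"
proof -
  let ?D = "mat_delete (char_poly_matrix (compartmental_matrix (mammillary (Suc m)) a)) 0 0"
  have D: "?D = mat m m (\<lambda>(i, j). if i = j then [:inflow a i, 1:] else 0)"
    unfolding char_poly_matrix_mammillary
    by (rule eq_matI) (auto simp: mat_delete_def arrow_mat_def)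
  show ?thesis unfolding D
    by (subst det_upper_triangular[where n = m])
      (auto simp: prod_list_diag_prod atLeast0LessThan in_poly_def root_poly_def)
qed

lemma coeff_map_mammillary:
  "coeff_map (mammillary (Suc m)) a = Matrix.vec (Suc m + m)
    (\<lambda>k. if k < Suc m then coeff (out_poly m a) k else coeff (in_poly m a) (k - Suc m))"
  unfolding coeff_map_def Let_def char_poly_mammillary minor_char_poly_mammillary
    num_compartments_mammillary by simp

subsection \<open>The Jacobian determinant\<close>

lemma in_poly_upd_notin:
  assumes "fst p \<noteq> Suc 0"
  shows "in_poly m (a(p := t)) = in_poly m a"
  unfolding in_poly_def root_poly_def using assms by (cases p) (auto intro!: prod.cong)

lemma in_poly_upd_inflow:
  assumes "l < m"
  shows "in_poly m (a((Suc 0, l + 2) := t)) = [:t, 1:] * root_poly (inflow a) ({..<m} - {l})"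
proof -
  have "inflow (a((Suc 0, l + 2) := t)) = (inflow a)(l := t)" by auto
  then show ?thesis
    unfolding in_poly_def using assms
    by (simp add: root_poly_remove[of "{..<m}" l] root_poly_upd_notin del: mult_pCons_left)
qed

lemma deriv_affine: "deriv (\<lambda>t. t * A + B) s = (A :: real)"
  by (rule DERIV_imp_deriv) (auto intro!: derivative_eq_intros)

lemma partial_deriv_affine:
  assumes "\<And>t. f (a(p := t)) = t * A + B"
  shows "partial_deriv f p a = A"
  by (simp add: partial_deriv_def assms deriv_affine)

lemma partial_deriv_in_poly_notin:
  assumes "fst p \<noteq> Suc 0"
  shows "partial_deriv (\<lambda>b. coeff (in_poly m b) k) p a = 0"
  using assms by (intro partial_deriv_affine[where B = "coeff (in_poly m a) k"])
    (auto simp: in_poly_upd_notin)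

lemma partial_deriv_in_poly_inflow:
  assumes "l < m"
  shows "partial_deriv (\<lambda>b. coeff (in_poly m b) k) (Suc 0, l + 2) a =
    coeff (root_poly (inflow a) ({..<m} - {l})) k"
  using assms unfolding in_poly_upd_inflow[OF assms]
  by (intro partial_deriv_affine[where
        B = "coeff ([:0, 1:] * root_poly (inflow a) ({..<m} - {l})) k"])
    (simp only: in_poly_upd_inflow, simp)

lemma partial_deriv_out_poly_leak:
  "partial_deriv (\<lambda>b. coeff (out_poly m b) k) (0, Suc 0) a = coeff (in_poly m a) k"
proof (rule partial_deriv_affine)
  fix t
  let ?b = "a((0, Suc 0) := t)"
  have "out_poly m ?b = [:t, 1:] * in_poly m a +
     [:0, 1:] * (\<Sum>l<m. Polynomial.smult (outflow a l) (root_poly (inflow a) ({..<m} - {l})))"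
    unfolding out_poly_def by (simp add: in_poly_upd_notin)
  then show "coeff (out_poly m ?b) k = t * coeff (in_poly m a) k +
    coeff ([:0, 1:] * in_poly m a +
     [:0, 1:] * (\<Sum>l<m. Polynomial.smult (outflow a l) (root_poly (inflow a) ({..<m} - {l})))) k"
    by (simp add: coeff_pCons split: nat.split)
qed

lemma partial_deriv_out_poly_outflow:
  assumes "l < m"
  shows "partial_deriv (\<lambda>b. coeff (out_poly m b) k) (l + 2, Suc 0) a =
    coeff ([:0, 1:] * root_poly (inflow a) ({..<m} - {l})) k"
proof (rule partial_deriv_affine)
  fix t
  let ?b = "a((l + 2, Suc 0) := t)" and ?D = "\<lambda>i. root_poly (inflow a) ({..<m} - {i})"
  have "(\<Sum>i<m. Polynomial.smult (outflow ?b i) (?D i)) =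
      Polynomial.smult t (?D l) + (\<Sum>i\<in>{..<m} - {l}. Polynomial.smult (outflow a i) (?D i))"
    using assms by (simp add: sum.remove[of "{..<m}" l])
  moreover have "inflow ?b = inflow a" "?b (0, Suc 0) = a (0, Suc 0)" by auto
  ultimately have "out_poly m ?b = [:a (0, Suc 0), 1:] * in_poly m a + [:0, 1:] *
     (Polynomial.smult t (?D l) + (\<Sum>i\<in>{..<m} - {l}. Polynomial.smult (outflow a i) (?D i)))"
    by (simp only: out_poly_def in_poly_def)
  then show "coeff (out_poly m ?b) k = t * coeff ([:0, 1:] * ?D l) k +
    coeff ([:a (0, Suc 0), 1:] * in_poly m a +
      [:0, 1:] * (\<Sum>i\<in>{..<m} - {l}. Polynomial.smult (outflow a i) (?D i))) k"
    by (simp add: coeff_pCons split: nat.split)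
qed

text \<open>In this order of the parameters the Jacobian matrix is block triangular.\<close>

definition param_order :: "nat \<Rightarrow> nat \<Rightarrow> nat \<times> nat" where
  "param_order m l = (if l = 0 then (0, Suc 0) else if l \<le> m then (l - 1 + 2, Suc 0)
     else (Suc 0, l - Suc m + 2))"

lemma bij_betw_param_order:
  "bij_betw (param_order m) {..<Suc m + m} (params (mammillary (Suc m)))"
proof (rule bij_betw_imageI)
  show "inj_on (param_order m) {..<Suc m + m}"
    by (auto simp: inj_on_def param_order_def split: if_splits)
  have "p \<in> param_order m ` {..<Suc m + m}" if "p \<in> params (mammillary (Suc m))" for p
    using that
  proof (cases rule: params_mammillary_cases)
    case leak
    then show ?thesis by (intro image_eqI[of _ _ 0]) (auto simp: param_order_def)
  next
    case (outflow l)
    then show ?thesis by (intro image_eqI[of _ _ "Suc l"]) (auto simp: param_order_def)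
  next
    case (inflow l)
    then show ?thesis by (intro image_eqI[of _ _ "Suc m + l"]) (auto simp: param_order_def)
  qed
  then show "param_order m ` {..<Suc m + m} = params (mammillary (Suc m))"
    by (auto simp: params_mammillary param_order_def image_iff)
qed

lemma det_coeff_jacobian_param_order:
  fixes a :: "nat \<times> nat \<Rightarrow> real" and m :: nat
  defines "J \<equiv> mat (Suc m + m) (Suc m + m) (\<lambda>(k, l).
      partial_deriv (\<lambda>x. vec_index (coeff_map (mammillary (Suc m)) x) k) (param_order m l) a)"
  shows "Determinant.det J =
    (\<Prod>l<m. inflow a l) * (\<Prod>(i, j) | i < j \<and> j < m. (inflow a i - inflow a j)\<^sup>2)"
proof -
  let ?C = "minor_coeff_mat (inflow a) m"
  \<comment> \<open>The derivatives of P in z and the y_l are D and \<lambda> D_l. The constant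
    coefficients of the latter vanish, and the factor \<lambda> shifts their other coefficients down
    one row, so that \<open>?C\<close> appears below row 0.\<close>
  define A where "A = four_block_mat (mat 1 1 (\<lambda>_. \<Prod>l<m. inflow a l)) (0\<^sub>m 1 m)
    (mat m 1 (\<lambda>(k, _). coeff (in_poly m a) (Suc k))) ?C"
  \<comment> \<open>This block lies opposite the zero block, so its entries can stay
    unevaluated.\<close>
  define B where "B = mat (Suc m) m (\<lambda>(k, l).
      partial_deriv (\<lambda>x. coeff (out_poly m x) k) (Suc 0, l + 2) a)"
  have A: "A \<in> carrier_mat (Suc m) (Suc m)"
    unfolding A_def using four_block_carrier_mat[of _ 1 1 ?C m m] by simp
  have coeff_map: "vec_index (coeff_map (mammillary (Suc m)) x) k =
      (if k < Suc m then coeff (out_poly m x) k else coeff (in_poly m x) (k - Suc m))"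
    if "k < Suc m + m" for k x
    using that by (simp add: coeff_map_mammillary)
  have "coeff (in_poly m a) 0 = (\<Prod>l<m. inflow a l)"
    using poly_root_poly[of "inflow a" "{..<m}" 0] by (simp add: in_poly_def poly_0_coeff_0)
  then have A_entry: "A $$ (k, l) = partial_deriv (\<lambda>x. coeff (out_poly m x) k) (param_order m l) a"
    if "k < Suc m" "l < Suc m" for k l
    using that partial_deriv_out_poly_leak[of m k a] partial_deriv_out_poly_outflow[of "l - 1" m k a]
    by (cases k; cases l) (auto simp: A_def four_block_mat_def Let_def minor_coeff_mat_def param_order_def)
  have "J = four_block_mat A B (0\<^sub>m m (Suc m)) ?C"
  proof (rule eq_matI, goal_cases)
    case (1 k l)
    then have kl: "k < Suc m + m" "l < Suc m + m" using A by (auto simp: minor_coeff_mat_def)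
    consider "k < Suc m" "l < Suc m" | "k < Suc m" "\<not> l < Suc m"
      | "\<not> k < Suc m" "l < Suc m" | "\<not> k < Suc m" "\<not> l < Suc m" by blast
    then show ?case
    proof cases
      case 1
      with kl A show ?thesis
        by (simp add: J_def coeff_map A_entry four_block_mat_def Let_def)
    next
      case 2
      with kl A show ?thesis
        by (simp add: J_def coeff_map B_def param_order_def four_block_mat_def Let_def)
    next
      case 3
      then have "fst (param_order m l) \<noteq> Suc 0" by (simp add: param_order_def)
      with 3 kl A show ?thesis
        by (simp add: J_def coeff_map partial_deriv_in_poly_notin four_block_mat_def Let_def)
    next
      case 4
      with kl A partial_deriv_in_poly_inflow[of "l - Suc m" m "k - Suc m" a] show ?thesis
        by (simp add: J_def coeff_map param_order_def minor_coeff_mat_def four_block_mat_def Let_def)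
    qed
  qed (use A in \<open>simp_all add: J_def minor_coeff_mat_def\<close>)
  also have "Determinant.det \<dots> = Determinant.det A * Determinant.det ?C"
    by (rule det_four_block_mat_lower_left_zero[OF A _ refl minor_coeff_mat_carrier])
      (simp add: B_def)
  also have "Determinant.det A = (\<Prod>l<m. inflow a l) * Determinant.det ?C"
    unfolding A_def by (subst det_four_block_mat_upper_right_zero) (auto simp: det_single)
  finally show ?thesis
    using det_minor_coeff_mat_square[of "inflow a" m] by (simp add: power2_eq_square mult.assoc)
qed

subsection \<open>Identifiability\<close>

text \<open>The exceptional set is a finite union of hyperplanes, each the graph of 0 or of another
  inflow coordinate.\<close>

lemma AE_inflow_generic:
  "AE a in param_measure (mammillary (Suc m)).
     (\<forall>l<m. inflow a l \<noteq> 0) \<and> (\<forall>i<m. \<forall>j<m. i \<noteq> j \<longrightarrow> inflow a i \<noteq> inflow a j)"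
proof -
  let ?I = "params (mammillary (Suc m))"
  have mem: "(Suc 0, l + 2) \<in> ?I" if "l < m" for l
    using that by (auto simp: params_mammillary)
  have fin: "finite ?I" by (simp add: params_mammillary)
  have "AE a in PiM ?I (\<lambda>_. lborel). inflow a l \<noteq> 0" if "l < m" for l
    by (rule AE_PiM_lborel_neq[OF fin mem[OF that]]) auto
  moreover have "AE a in PiM ?I (\<lambda>_. lborel). inflow a i \<noteq> inflow a j"
    if "i < m" "j < m" "i \<noteq> j" for i j
    using measurable_component_singleton[OF mem[OF \<open>j < m\<close>], of "\<lambda>_. lborel"] that
    by (intro AE_PiM_lborel_neq[OF fin mem]) auto
  ultimately show ?thesis
    unfolding param_measure_def by (auto simp: AE_all_countable)
qed

text \<open>Both polynomials are monic of degree \<open>m\<close>, so the \<open>m\<close> lower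
  coefficients recorded by the coefficient map suffice.\<close>

lemma in_poly_eqI:
  assumes "\<And>k. k < m \<Longrightarrow> coeff (in_poly m a) k = coeff (in_poly m b) k"
  shows "in_poly m a = in_poly m b"
proof (rule poly_eqI)
  fix k
  consider "k < m" | "k = m" | "m < k" by linarith
  then show "coeff (in_poly m a) k = coeff (in_poly m b) k"
  proof cases
    case 1
    then show ?thesis by (rule assms)
  next
    case 2
    then show ?thesis
      using coeff_root_poly_card[of "inflow a" "{..<m}"] coeff_root_poly_card[of "inflow b" "{..<m}"]
      by (simp add: in_poly_def)
  qed (simp add: in_poly_def coeff_root_poly_eq_0)
qed

lemma poly_in_poly_eq_0_iff: "poly (in_poly m a) t = 0 \<longleftrightarrow> (\<exists>l<m. t = - inflow a l)"
  by (auto simp: in_poly_def poly_root_poly add_eq_0_iff)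

text \<open>The difference of the two output polynomials vanishes identically, and its values at \<open>0\<close>
  and at the roots of the input polynomial isolate the individual parameters.\<close>

lemma out_poly_eq_imp_params_eq:
  assumes coeffs: "\<And>k. k < Suc m \<Longrightarrow> coeff (out_poly m a) k = coeff (out_poly m b) k"
    and inflow: "\<And>l. l < m \<Longrightarrow> inflow a l = inflow b l"
    and nz: "\<And>l. l < m \<Longrightarrow> inflow a l \<noteq> 0"
    and inj: "inj_on (inflow a) {..<m}"
  shows "a (0, Suc 0) = b (0, Suc 0)" and "\<And>l. l < m \<Longrightarrow> outflow a l = outflow b l"
proof -
  let ?D = "\<lambda>l. root_poly (inflow a) ({..<m} - {l})"
  define z where "z = a (0, Suc 0) - b (0, Suc 0)"
  define y where "y = (\<lambda>l. outflow a l - outflow b l)"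
  have D: "root_poly (inflow b) S = root_poly (inflow a) S" if "S \<subseteq> {..<m}" for S
    unfolding root_poly_def using that inflow by (intro prod.cong) auto
  have in_eq: "in_poly m b = in_poly m a"
    unfolding in_poly_def by (rule D) simp
  define Q where "Q = Polynomial.smult z (in_poly m a) + [:0, 1:] * (\<Sum>l<m. Polynomial.smult (y l) (?D l))"
  have Q: "Q = out_poly m a - out_poly m b"
  proof -
    have "(\<Sum>l<m. Polynomial.smult (outflow b l) (root_poly (inflow b) ({..<m} - {l}))) =
        (\<Sum>l<m. Polynomial.smult (outflow b l) (?D l))"
      by (intro sum.cong refl arg_cong2[of _ _ _ _ Polynomial.smult] D) auto
    moreover have "[:a (0, Suc 0), 1:] - [:b (0, Suc 0), 1:] = [:z:]"
      by (simp add: z_def)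
    ultimately show ?thesis
      unfolding Q_def out_poly_def in_eq y_def
      by (simp only: smult_diff_left sum_subtractf right_diff_distrib) (simp add: z_def smult_diff_left)
  qed
  \<comment> \<open>The hypothesis covers the coefficients up to degree \<open>m\<close>, and the
    form of \<open>Q\<close> in \<open>Q_def\<close> bounds its degree by \<open>m\<close>.\<close>
  have "Q = 0"
  proof (rule poly_eqI)
    fix k
    show "coeff Q k = coeff 0 k"
    proof (cases "k < Suc m")
      case True
      then show ?thesis by (simp add: Q coeffs)
    next
      case False
      then obtain k' where k': "k = Suc k'" by (cases k) auto
      have "coeff (?D l) k' = 0" if "l < m" for l
        using that False k' by (intro coeff_root_poly_eq_0) auto
      moreover have "coeff (in_poly m a) k = 0"
        unfolding in_poly_def using False by (intro coeff_root_poly_eq_0) auto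
      ultimately show ?thesis
        by (simp add: Q_def k' coeff_sum)
    qed
  qed
  have "poly Q 0 = z * (\<Prod>l<m. inflow a l)"
    by (simp add: Q_def in_poly_def poly_root_poly)
  then have "z = 0" using \<open>Q = 0\<close> nz by auto
  then show "a (0, Suc 0) = b (0, Suc 0)" by (simp add: z_def)
  fix l assume l: "l < m"
  have "poly (?D i) (- inflow a l) = 0" if "i < m" "i \<noteq> l" for i
    using that l by (auto simp: poly_root_poly)
  then have "(\<Sum>i\<in>{..<m} - {l}. y i * poly (?D i) (- inflow a l)) = 0"
    by (intro sum.neutral) auto
  then have "poly (\<Sum>i<m. Polynomial.smult (y i) (?D i)) (- inflow a l) =
      y l * poly (?D l) (- inflow a l)"
    using l by (simp add: poly_sum sum.remove[of "{..<m}" l])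
  then have "poly Q (- inflow a l) = - inflow a l * (y l * poly (?D l) (- inflow a l))"
    by (simp add: Q_def \<open>z = 0\<close>)
  moreover have "poly (?D l) (- inflow a l) \<noteq> 0"
    using l inj by (auto simp: poly_root_poly inj_on_def)
  ultimately have "y l = 0" using \<open>Q = 0\<close> nz[OF l] by simp
  then show "outflow a l = outflow b l" by (simp add: y_def)
qed

lemma generically_locally_identifiable_mammillary:
  "generically_locally_identifiable (mammillary (Suc m))"
  unfolding generically_locally_identifiable_def
proof (rule AE_mp[OF AE_inflow_generic AE_I2], safe)
  let ?M = "mammillary (Suc m)"
  fix a
  assume a: "a \<in> space (param_measure ?M)"
    and nz: "\<forall>l<m. inflow a l \<noteq> 0"
    and dist: "\<forall>i<m. \<forall>j<m. i \<noteq> j \<longrightarrow> inflow a i \<noteq> inflow a j"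
  obtain e where "e > 0" and e: "\<And>i j. i < m \<Longrightarrow> j < m \<Longrightarrow> i \<noteq> j \<Longrightarrow> 2 * e \<le> \<bar>inflow a i - inflow a j\<bar>"
  proof
    \<comment> \<open>The element 1 keeps the set nonempty when there is no pair of distinct
      indices.\<close>
    let ?S = "insert 1 {\<bar>inflow a i - inflow a j\<bar> |i j. i < m \<and> j < m \<and> i \<noteq> j}"
    have fin: "finite ?S"
      by (rule finite_subset[of _ "insert 1 ((\<lambda>(i, j). \<bar>inflow a i - inflow a j\<bar>) ` ({..<m} \<times> {..<m}))"]) auto
    show "Min ?S / 2 > 0" using fin dist by (auto simp: Min_gr_iff)
    show "2 * (Min ?S / 2) \<le> \<bar>inflow a i - inflow a j\<bar>" if "i < m" "j < m" "i \<noteq> j" for i j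
      using Min_le[OF fin, of "\<bar>inflow a i - inflow a j\<bar>"] that by auto
  qed
  \<comment> \<open>Only inflows are restricted: the balls are too small for two inflows to be
    exchanged, and 0 is removed so that every point of \<open>?U\<close> meets the nonvanishing
    hypothesis. Leak and outflows range freely.\<close>
  define S where "S p = (if fst p = Suc 0 then ball (a p) e - {0} else UNIV)" for p :: "nat \<times> nat"
  let ?U = "\<Pi>\<^sub>E p\<in>params ?M. S p"
  have param_in: "(Suc 0, l + 2) \<in> params ?M" if "l < m" for l
    using that by (auto simp: params_mammillary)
  have "open (S p)" for p
    by (auto simp: S_def open_Diff)
  then have "openin (param_topology ?M) ?U"
    by (simp add: param_topology_def openin_PiE params_mammillary)
  moreover have "a \<in> ?U"
  proof -
    have "a p \<in> S p" if "p \<in> params ?M" for p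
      using that nz \<open>e > 0\<close>
      by (cases rule: params_mammillary_cases) (auto simp: S_def)
    with a show ?thesis by (auto simp: param_measure_def space_PiM PiE_iff)
  qed
  moreover have "inj_on (coeff_map ?M) ?U"
  proof (rule inj_onI)
    fix b c assume b: "b \<in> ?U" and c: "c \<in> ?U" and eq: "coeff_map ?M b = coeff_map ?M c"
    have near: "inflow x l \<noteq> 0" "\<bar>inflow a l - inflow x l\<bar> < e" if "x \<in> ?U" "l < m" for x l
      using PiE_mem[OF \<open>x \<in> ?U\<close> param_in[OF \<open>l < m\<close>]] by (auto simp: S_def dist_real_def)
    \<comment> \<open>For \<open>i\<close> and \<open>j\<close> distinct, the common value would lie
      within \<open>e\<close> of two centres at least \<open>2 * e\<close> apart. The two points
      \<open>x\<close> and \<open>y\<close> may differ, so this also matches roots across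
      points.\<close>
    have sep: "i = j" if "x \<in> ?U" "y \<in> ?U" "i < m" "j < m" "inflow x i = inflow y j" for x y i j
      using near(2)[OF that(1,3)] near(2)[OF that(2,4)] e[OF that(3,4)] that(5)
      by (cases "i = j") auto
    have coeffs: "(if k < Suc m then coeff (out_poly m b) k else coeff (in_poly m b) (k - Suc m)) =
        (if k < Suc m then coeff (out_poly m c) k else coeff (in_poly m c) (k - Suc m))"
      if "k < Suc m + m" for k
      using arg_cong[OF eq, of "\<lambda>v. vec_index v k"] that by (simp add: coeff_map_mammillary)
    have in_eq: "in_poly m b = in_poly m c"
    proof (rule in_poly_eqI)
      fix k assume "k < m"
      with coeffs[of "Suc m + k"] show "coeff (in_poly m b) k = coeff (in_poly m c) k" by simp
    qed
    \<comment> \<open>Equal polynomials give equal roots up to a permutation, which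
      \<open>sep\<close> forces to be the identity.\<close>
    have inflow: "inflow b l = inflow c l" if l: "l < m" for l
    proof -
      have "poly (in_poly m b) (- inflow b l) = 0"
        using l by (auto simp: poly_in_poly_eq_0_iff)
      then obtain i where "i < m" "inflow b l = inflow c i"
        by (auto simp: in_eq poly_in_poly_eq_0_iff)
      with sep[OF c b _ l] show ?thesis by metis
    qed
    have inj: "inj_on (inflow b) {..<m}"
      using sep[OF b b] by (auto simp: inj_on_def)
    have out: "coeff (out_poly m b) k = coeff (out_poly m c) k" if "k < Suc m" for k
      using coeffs[of k] that by simp
    note params_eq = out_poly_eq_imp_params_eq[OF out inflow near(1)[OF b] inj]
    show "b = c"
    proof (rule PiE_ext[OF b c])
      fix p assume "p \<in> params ?M"
      then show "b p = c p"
        by (cases rule: params_mammillary_cases) (use params_eq inflow in auto)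
    qed
  qed
  ultimately show "\<exists>U. openin (param_topology ?M) U \<and> a \<in> U \<and> inj_on (coeff_map ?M) U"
    by blast
qed

section \<open>The singular locus for arbitrary orders of coefficients and parameters\<close>

lemma prod_pairs_shift:
  "(\<Prod>(i, j) | 2 \<le> i \<and> i < j \<and> j \<le> Suc m. f i j) = (\<Prod>(i, j) | i < j \<and> j < m. f (i + 2) (j + 2))"
  by (rule prod.reindex_bij_witness[of _ "\<lambda>(i, j). (i + 2, j + 2)" "\<lambda>(i, j). (i - 2, j - 2)"])
    (auto simp del: add_2_eq_Suc')

lemma singular_locus_equation_mammillary:
  "singular_locus_equation (mammillary (Suc m))
    (\<lambda>a. (\<Prod>l<m. inflow a l) * (\<Prod>(i, j) | i < j \<and> j < m. (inflow a i - inflow a j)\<^sup>2))"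
  (is "singular_locus_equation ?M ?f")
  unfolding singular_locus_equation_def
proof (intro conjI allI impI)
  let ?N = "Suc m + m"
  show fin: "finite (params ?M)" by (simp add: params_mammillary)
  show card: "card (params ?M) = num_coeffs ?M"
    using bij_betw_same_card[OF bij_betw_param_order[of m]] by simp
  fix \<sigma> \<tau>
  assume \<sigma>: "bij_betw \<sigma> {..<num_coeffs ?M} {..<num_coeffs ?M}"
    and \<tau>: "bij_betw \<tau> {..<card (params ?M)} (params ?M)"
  \<comment> \<open>\<open>\<pi>\<close> expresses the order \<open>\<tau>\<close> through
    \<open>param_order\<close>, so that an arbitrary Jacobian matrix is a row and column permutation
    of the block triangular one.\<close>
  define \<pi> where "\<pi> = inv_into {..<?N} (param_order m) \<circ> \<tau>"
  have \<pi>: "bij_betw \<pi> {..<?N} {..<?N}"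
    unfolding \<pi>_def using \<tau> unfolding card num_coeffs_mammillary
    by (rule bij_betw_trans[OF _ bij_betw_inv_into[OF bij_betw_param_order]])
  have order_\<pi>: "param_order m (\<pi> l) = \<tau> l" if "l < ?N" for l
  proof -
    have "\<tau> l \<in> params ?M"
      using \<tau> that card by (auto simp: bij_betw_def)
    then show ?thesis
      using bij_betw_inv_into_right[OF bij_betw_param_order] by (simp add: \<pi>_def)
  qed
  have \<sigma>': "bij_betw \<sigma> {..<?N} {..<?N}" using \<sigma> by simp
  obtain s :: real where s: "s \<in> {1, -1}" and det: "\<And>A. A \<in> carrier_mat ?N ?N \<Longrightarrow>
      Determinant.det (mat ?N ?N (\<lambda>(i, j). A $$ (\<sigma> i, \<pi> j))) = s * Determinant.det A"
    using det_permute[OF \<sigma>' \<pi>] by blast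
  have "Determinant.det (coeff_jacobian ?M \<sigma> \<tau> a) = s * ?f a" for a
  proof -
    let ?J = "mat ?N ?N (\<lambda>(k, l). partial_deriv (\<lambda>x. vec_index (coeff_map ?M x) k) (param_order m l) a)"
    have lt: "\<sigma> k < ?N" "\<pi> k < ?N" if "k < ?N" for k
      using \<sigma>' \<pi> that by (auto simp: bij_betw_def)
    have "coeff_jacobian ?M \<sigma> \<tau> a = mat ?N ?N (\<lambda>(k, l). ?J $$ (\<sigma> k, \<pi> l))"
      unfolding coeff_jacobian_def card num_coeffs_mammillary
      using lt order_\<pi> by (intro eq_matI) auto
    then show ?thesis
      by (simp only: det[OF mat_carrier] det_coeff_jacobian_param_order)
  qed
  with s show "\<exists>s\<in>{1, -1}. \<forall>a\<in>param_space ?M. Determinant.det (coeff_jacobian ?M \<sigma> \<tau> a) = s * ?f a"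
    by blast
qed

theorem theorem5p1:
  fixes n :: nat
  assumes "n \<ge> 2"
  shows "generically_locally_identifiable (mammillary n) \<and>
    singular_locus_equation (mammillary n)
      (\<lambda>a. (\<Prod>j=2..n. a (1, j)) *
           (\<Prod>(i, j) | 2 \<le> i \<and> i < j \<and> j \<le> n. (a (1, i) - a (1, j)) ^ 2))"
proof -
  obtain m where n: "n = Suc m" using assms by (cases n) auto
  have "(\<Prod>j=2..Suc m. a (1, j)) = (\<Prod>l<m. inflow a l)" for a :: "nat \<times> nat \<Rightarrow> real"
    by (rule prod.reindex_bij_witness[of _ "\<lambda>l. l + 2" "\<lambda>j. j - 2"])
      (auto simp del: add_2_eq_Suc')
  then show ?thesis
    unfolding n prod_pairs_shift
    using generically_locally_identifiable_mammillary singular_locus_equation_mammillary by simp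
qed

end
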